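(* Let $M,N:\mathbb{R}_+^2\to\mathbb{R}$ be two symmetric, homogeneous means and let $m,n:(0,1)\to\mathbb{R}$ be their respective Seiffert functions. If the function $\frac{n}{m}$ is decreasing on $(0,1)$, then for all $0<x,y\leq 1/2$ the inequality $$\frac{M(x,y)}{M(1-x,1-y)}\leq \frac{N(x,y)}{N(1-x,1-y)}$$ holds.
   Context: Here $\mathbb{R}_+=(0,\infty)$. A function $M:\mathbb{R}_+^2\to\mathbb{R}$ is called a mean if $\min(x,y)\leq M(x,y)\leq\max(x,y)$ for all $x,y>0$. It is symmetric if $M(x,y)=M(y,x)$ for all $x,y>0$, and homogeneous if $M(\lambda x,\lambda y)=\lambda M(x,y)$ for all $\lambda,x,y>0$. A Seiffert function is a function $m:(0,1)\to\mathbb{R}$ satisfying $\frac{z}{1+z}\leq m(z)\leq\frac{z}{1-z}$ for all $z\in(0,1)$. The Seiffert function of a symmetric, homogeneous mean $M$ is $m(z)=\frac{z}{M(1+z,1-z)}$ for $z\in(0,1)$. Equivalently, it is the unique Seiffert function $m$ such that $M(x,y)=\frac{|x-y|}{2m\left(\frac{|x-y|}{x+y}\right)}$ for all $x,y>0$ with $x\neq y$ (while $M(x,x)=x$). This formula establishes a one-to-one correspondence between symmetric, homogeneous means and Seiffert functions. *)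

theory Defs
  imports Complex_Main
begin

text \<open>
  A mean, a function \<open>(0,\<infinity>)\<^sup>2 \<rightarrow> \<real>\<close>, is a curried total function; its values matter only at
  positive arguments.  Similarly, only the values of a Seiffert function on \<open>(0,1)\<close> matter.
\<close>

definition is_mean :: "(real \<Rightarrow> real \<Rightarrow> real) \<Rightarrow> bool" where
  "is_mean M \<longleftrightarrow> (\<forall>x>0. \<forall>y>0. min x y \<le> M x y \<and> M x y \<le> max x y)"

definition symmetric_mean :: "(real \<Rightarrow> real \<Rightarrow> real) \<Rightarrow> bool" where
  "symmetric_mean M \<longleftrightarrow> is_mean M \<and> (\<forall>x>0. \<forall>y>0. M x y = M y x)"

definition homogeneous_mean :: "(real \<Rightarrow> real \<Rightarrow> real) \<Rightarrow> bool" where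
  "homogeneous_mean M \<longleftrightarrow>
     is_mean M \<and> (\<forall>l>0. \<forall>x>0. \<forall>y>0. M (l * x) (l * y) = l * M x y)"

definition seiffert_function_of :: "(real \<Rightarrow> real) \<Rightarrow> (real \<Rightarrow> real \<Rightarrow> real) \<Rightarrow> bool" where
  "seiffert_function_of m M \<longleftrightarrow> (\<forall>z\<in>{0<..<1}. m z = z / M (1 + z) (1 - z))"

end

theory Submission
  imports Defs
begin

text \<open>
  By homogeneity, \<open>M(x,y)/N(x,y) = (n/m)(|x - y|/(x + y))\<close> for \<open>x \<noteq> y\<close>. Passing from \<open>(x,y)\<close> to
  \<open>(1-x,1-y)\<close> keeps \<open>|x - y|\<close> and, as \<open>x + y \<le> 1\<close>, does not decrease the denominator, so the
  argument of \<open>n/m\<close> does not increase.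
\<close>

lemma is_mean_pos:
  assumes "is_mean M" "x > 0" "y > 0"
  shows "M x y > 0"
proof -
  have "min x y \<le> M x y"
    using assms unfolding is_mean_def by blast
  with assms(2,3) show ?thesis by linarith
qed

lemma is_mean_diag:
  assumes "is_mean M" "x > 0"
  shows "M x x = x"
proof -
  have "min x x \<le> M x x \<and> M x x \<le> max x x"
    using assms unfolding is_mean_def by blast
  then show ?thesis by simp
qed

text \<open>Scaling by the arithmetic mean \<open>(x + y) / 2\<close> sends
  \<open>(1 + z, 1 - z)\<close> to \<open>(x, y)\<close> exactly when
  \<open>z = (x - y) / (x + y)\<close>, which is where the argument of the Seiffert function comes
  from.\<close>

lemma homogeneous_mean_normalize:
  assumes "homogeneous_mean M" "0 < y" "y < x"
  shows "M x y = (x + y) / 2 * M (1 + (x - y) / (x + y)) (1 - (x - y) / (x + y))"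
proof -
  let ?l = "(x + y) / 2" and ?z = "(x - y) / (x + y)"
  have "?l > 0" "1 + ?z > 0" "1 - ?z > 0"
    using assms(2,3) by (auto simp: field_simps)
  then have "M (?l * (1 + ?z)) (?l * (1 - ?z)) = ?l * M (1 + ?z) (1 - ?z)"
    using assms(1) unfolding homogeneous_mean_def by blast
  moreover have "?l * (1 + ?z) = x" "?l * (1 - ?z) = y"
    using assms(2,3) by (auto simp: field_simps)
  ultimately show ?thesis by (simp only:)
qed

text \<open>After normalization the common factor \<open>(x + y) / 2\<close> cancels, as does the
  numerator \<open>z\<close> of \<open>m z\<close> and \<open>n z\<close>. Each mean sits in the
  denominator of its Seiffert function, so the roles of \<open>m\<close> and \<open>n\<close>
  swap.\<close>

lemma mean_ratio_eq_seiffert_ratio: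
  assumes "homogeneous_mean M" "homogeneous_mean N"
    and "seiffert_function_of m M" "seiffert_function_of n N"
    and "0 < y" "y < x"
  shows "M x y / N x y = n ((x - y) / (x + y)) / m ((x - y) / (x + y))"
proof -
  let ?z = "(x - y) / (x + y)"
  have z: "?z \<in> {0<..<1}"
    using assms(5,6) by (auto simp: field_simps)
  have "m ?z = ?z / M (1 + ?z) (1 - ?z)" "n ?z = ?z / N (1 + ?z) (1 - ?z)"
    using assms(3,4) z unfolding seiffert_function_of_def by blast+
  moreover have "?z \<noteq> 0" "(x + y) / 2 \<noteq> 0"
    using assms(5,6) by auto
  ultimately show ?thesis
    unfolding homogeneous_mean_normalize[OF assms(1,5,6)]
      homogeneous_mean_normalize[OF assms(2,5,6)]
    by simp
qed

text \<open>Reflection reverses the order of the two arguments; writing \<open>1 - y\<close> first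
  keeps the larger one in front, so the ratio formula applies at both points without
  symmetry.\<close>

lemma mean_ratio_reflect_le:
  assumes "homogeneous_mean M" "homogeneous_mean N"
    and "seiffert_function_of m M" "seiffert_function_of n N"
    and anti: "antimono_on {0<..<1} (\<lambda>z. n z / m z)"
    and xy: "0 < y" "y < x" "x \<le> 1/2"
  shows "M x y / N x y \<le> M (1 - y) (1 - x) / N (1 - y) (1 - x)"
proof -
  let ?z = "(x - y) / (x + y)" and ?w = "((1 - y) - (1 - x)) / ((1 - y) + (1 - x))"
  have "?z \<in> {0<..<1}" "?w \<in> {0<..<1}"
    using xy by (auto simp: field_simps)
  moreover have "?w \<le> ?z"
    using xy by (intro frac_le) auto
  ultimately have "n ?z / m ?z \<le> n ?w / m ?w"
    using monotone_onD[OF anti] by blast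
  moreover have "M x y / N x y = n ?z / m ?z"
    using mean_ratio_eq_seiffert_ratio[OF assms(1-4) xy(1,2)] .
  moreover have "M (1 - y) (1 - x) / N (1 - y) (1 - x) = n ?w / m ?w"
    using xy by (intro mean_ratio_eq_seiffert_ratio[OF assms(1-4)]) auto
  ultimately show ?thesis by (simp only:)
qed

theorem theorem3p1:
  fixes M N :: "real \<Rightarrow> real \<Rightarrow> real" and m n :: "real \<Rightarrow> real"
  assumes "symmetric_mean M" and "homogeneous_mean M"
    and "symmetric_mean N" and "homogeneous_mean N"
    and "seiffert_function_of m M" and "seiffert_function_of n N"
    and "antimono_on {0<..<1} (\<lambda>z. n z / m z)"
  shows "\<forall>x y. 0 < x \<and> x \<le> 1/2 \<and> 0 < y \<and> y \<le> 1/2 \<longrightarrow>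
           M x y / M (1 - x) (1 - y) \<le> N x y / N (1 - x) (1 - y)"
proof (intro allI impI)
  fix x y :: real
  assume xy: "0 < x \<and> x \<le> 1/2 \<and> 0 < y \<and> y \<le> 1/2"
  have mean: "is_mean M" "is_mean N"
    using assms(1,3) unfolding symmetric_mean_def by auto
  have sym: "M a b = M b a" "N a b = N b a" if "a > 0" "b > 0" for a b
    using assms(1,3) that unfolding symmetric_mean_def by auto
  note reflect = mean_ratio_reflect_le[OF assms(2,4,5,6,7)]
  have pos: "M x y > 0" "N x y > 0" "M (1 - x) (1 - y) > 0" "N (1 - x) (1 - y) > 0"
    using xy by (simp_all add: is_mean_pos[OF mean(1)] is_mean_pos[OF mean(2)])
  \<comment> \<open>As all four values are positive, cross-multiplication makes this equivalent to
    the goal.\<close>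
  have "M x y / N x y \<le> M (1 - x) (1 - y) / N (1 - x) (1 - y)"
  proof (cases x y rule: linorder_cases)
    \<comment> \<open>The reflected pair \<open>(1 - x, 1 - y)\<close> is already in decreasing
      order, so symmetry is applied at \<open>(x, y)\<close>; for \<open>y < x\<close> it is the
      other way round.\<close>
    case less
    then show ?thesis
      using reflect[of x y] sym[of x y] xy by simp
  next
    \<comment> \<open>Here \<open>z = 0\<close> lies outside the domain of the Seiffert functions,
      but both quotients are 1.\<close>
    case equal
    then show ?thesis
      using xy by (simp add: is_mean_diag[OF mean(1)] is_mean_diag[OF mean(2)])
  next
    case greater
    then show ?thesis
      using reflect[of y x] sym[of "1 - x" "1 - y"] xy by simp
  qed
  with pos show "M x y / M (1 - x) (1 - y) \<le> N x y / N (1 - x) (1 - y)"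
    by (simp add: field_simps)
qed

end
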